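(* Let $K$ be any field. Then the following subalgebras are ideals of the Lie algebra $\mathfrak{gl}_{cf}(\mathbb{N},K)$, and they are the only ideals of $\mathfrak{gl}_{cf}(\mathbb{N},K)$: $\{0\}$; $\mathfrak{d}_{sc}(\mathbb{N},K)$; $\mathfrak{sl}_{fr}(\mathbb{N},K)$; $\mathfrak{gl}_{fr}(\mathbb{N},K)$; $\mathfrak{d}_{sc}(\mathbb{N},K)\oplus\mathfrak{sl}_{fr}(\mathbb{N},K)$; $\mathfrak{J}_k$ for $k\in K\setminus\{0\}$; $\mathfrak{d}_{sc}(\mathbb{N},K)\oplus\mathfrak{gl}_{fr}(\mathbb{N},K)$; and $\mathfrak{gl}_{cf}(\mathbb{N},K)$.
   Context: $\mathbb{N}$ denotes the positive integers and $K$ is a field. $\mathfrak{gl}_{cf}(\mathbb{N},K)$ is the set of all $\mathbb{N}\times\mathbb{N}$ matrices over $K$ having only finitely many nonzero entries in each column (column-finite matrices), regarded as a Lie algebra over $K$ with $[A,B]=AB-BA$. An ideal is a $K$-subspace $\mathfrak{I}$ with $[\mathfrak{gl}_{cf}(\mathbb{N},K),\mathfrak{I}]\subseteq\mathfrak{I}$. $E$ is the infinite identity matrix, and $E_{ij}$ is the matrix with $1$ in entry $(i,j)$ and zeros elsewhere. $\mathfrak{d}_{sc}(\mathbb{N},K)=\{\alpha E:\alpha\in K\}$ is the subalgebra of scalar matrices. $\mathfrak{gl}_{fr}(\mathbb{N},K)$ is the subalgebra of those matrices in $\mathfrak{gl}_{cf}(\mathbb{N},K)$ that have nonzero entries in only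 finitely many rows. For $A=(a_{ij})\in\mathfrak{gl}_{fr}(\mathbb{N},K)$ the trace is $\mathrm{Tr}(A)=\sum_i a_{ii}$ (a finite sum), and $\mathfrak{sl}_{fr}(\mathbb{N},K)=\{A\in\mathfrak{gl}_{fr}(\mathbb{N},K):\mathrm{Tr}(A)=0\}$. The symbol $\oplus$ denotes the (internal) direct sum inside $\mathfrak{gl}_{cf}(\mathbb{N},K)$. For $k\in K$, $\mathfrak{J}_k=\{m(E+kE_{11}): m\in K\}\oplus\mathfrak{sl}_{fr}(\mathbb{N},K)$ (sum of subspaces). *)

theory Defs
  imports
    Complex_Main
    "HOL-Library.Function_Algebras"
    "HOL-Library.Set_Algebras"
    "HOL-Library.Groups_Big_Fun"
begin

text \<open>
  Infinite matrices are functions of a row and a column index.  The positive integers are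
  represented by \<^typ>\<open>nat\<close>, shifted by one, so row and column 1 have index \<open>0\<close>.  Zero, sum and
  difference of matrices are the pointwise ones of \<^theory>\<open>HOL-Library.Function_Algebras\<close>; the
  pointwise product \<open>*\<close> defined there is not the matrix product and is not used.  The sum
  \<open>U + W\<close> of two sets of matrices is that of \<^theory>\<open>HOL-Library.Set_Algebras\<close>.
\<close>

type_synonym 'k imat = "nat \<Rightarrow> nat \<Rightarrow> 'k"

definition imat_scale :: "'k::field \<Rightarrow> 'k imat \<Rightarrow> 'k imat" where
  "imat_scale c A = (\<lambda>i j. c * A i j)"

global_interpretation imat: vector_space "imat_scale :: 'k::field \<Rightarrow> 'k imat \<Rightarrow> 'k imat"
  by unfold_locales (auto simp: imat_scale_def fun_eq_iff algebra_simps)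

text \<open>
  \<^const>\<open>Sum_any\<close> sums over the (finite) support of its argument.  If \<open>B\<close> is column-finite, the
  support is finite in every entry of the product.
\<close>

definition imat_mult :: "'k::field imat \<Rightarrow> 'k imat \<Rightarrow> 'k imat"  (infixl "**\<^sub>\<infinity>" 70) where
  "A **\<^sub>\<infinity> B = (\<lambda>i j. Sum_any (\<lambda>k. A i k * B k j))"

definition lie_bracket :: "'k::field imat \<Rightarrow> 'k imat \<Rightarrow> 'k imat" where
  "lie_bracket A B = A **\<^sub>\<infinity> B - B **\<^sub>\<infinity> A"

definition imat_id :: "'k::field imat" where
  "imat_id = (\<lambda>i j. if i = j then 1 else 0)"

definition imat_unit :: "nat \<Rightarrow> nat \<Rightarrow> 'k::field imat" where
  "imat_unit p q = (\<lambda>i j. if i = p \<and> j = q then 1 else 0)"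

definition gl_cf :: "'k::field imat set" where
  "gl_cf = {A. \<forall>j. finite {i. A i j \<noteq> 0}}"

definition lie_subalgebra :: "'k::field imat set \<Rightarrow> bool" where
  "lie_subalgebra S \<longleftrightarrow>
     S \<subseteq> gl_cf \<and> imat.subspace S \<and> (\<forall>A\<in>S. \<forall>B\<in>S. lie_bracket A B \<in> S)"

definition lie_ideal :: "'k::field imat set \<Rightarrow> bool" where
  "lie_ideal I \<longleftrightarrow>
     I \<subseteq> gl_cf \<and> imat.subspace I \<and> (\<forall>A\<in>gl_cf. \<forall>B\<in>I. lie_bracket A B \<in> I)"

lemma lie_ideal_imp_lie_subalgebra: "lie_ideal I \<Longrightarrow> lie_subalgebra I"
  by (auto simp: lie_ideal_def lie_subalgebra_def)

definition d_sc :: "'k::field imat set" where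
  "d_sc = {imat_scale \<alpha> imat_id |\<alpha>. True}"

definition gl_fr :: "'k::field imat set" where
  "gl_fr = {A \<in> gl_cf. finite {i. \<exists>j. A i j \<noteq> 0}}"

definition imat_trace :: "'k::field imat \<Rightarrow> 'k" where
  "imat_trace A = Sum_any (\<lambda>i. A i i)"

definition sl_fr :: "'k::field imat set" where
  "sl_fr = {A \<in> gl_fr. imat_trace A = 0}"

text \<open>\<open>E\<^sub>1\<^sub>1\<close> is \<^term>\<open>imat_unit 0 0\<close>.\<close>

definition J_line :: "'k::field \<Rightarrow> 'k imat set" where
  "J_line k = {imat_scale m (imat_id + imat_scale k (imat_unit 0 0)) |m. True}"

definition J_ideal :: "'k::field \<Rightarrow> 'k imat set" where
  "J_ideal k = J_line k + sl_fr"

end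

theory Submission
  imports Defs "HOL-Library.Infinite_Set"
begin

text \<open>
  Below, \<open>E_ij\<close> are the matrix units and \<open>E\<close> is the identity.

  \<^bold>\<open>The listed sets are ideals.\<close>  Scalar matrices are central, and the bracket of a column-finite
  matrix with a matrix having finitely many nonzero rows again has finitely many nonzero rows, and
  trace \<open>0\<close> (\<open>lie_bracket_gl_fr_in_sl_fr\<close>).  So \<open>d_sc + gl_fr\<close> is bracketed into \<open>sl_fr\<close>, and every
  subspace between these two is an ideal (\<open>lie_ideal_between\<close>).  The quotient of \<open>d_sc + gl_fr\<close> by
  \<open>sl_fr\<close> is the plane spanned by the classes of \<open>E\<close> and \<open>E_00\<close>; its subspaces are \<open>0\<close>, the whole
  plane and the lines, which give the ideals \<open>sl_fr\<close>, \<open>d_sc + gl_fr\<close>, \<open>gl_fr\<close> (the line of \<open>E_00\<close>)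
  and \<open>J_ideal k\<close> (the line of \<open>E + k E_00\<close>; for \<open>k = 0\<close> this is \<open>d_sc + sl_fr\<close>).  The remaining ideals are \<open>gl_cf\<close> and the
  central ones, \<open>{0}\<close> and \<open>d_sc\<close>.

  \<^bold>\<open>There are no others.\<close>  Given the above, two facts are needed about an ideal \<open>I\<close>.

  If \<open>I\<close> has a non-scalar element, then it contains \<open>sl_fr\<close> (\<open>sl_fr_subset_lie_ideal\<close>).  Brackets
  with two matrix units produce some \<open>E_it\<close> with \<open>t \<noteq> i\<close> for every \<open>i\<close>; the bracket of \<open>E_it\<close> with
  a matrix concentrated in row \<open>t\<close> gives every matrix concentrated in row \<open>i\<close> with \<open>0\<close> on the
  diagonal, even with infinitely many nonzero entries.

  If \<open>I\<close> has an element \<open>A\<close> outside \<open>d_sc + gl_fr\<close>, then \<open>I = gl_cf\<close> (\<open>lie_ideal_eq_gl_cf\<close>).  The goal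
  is an element \<open>X\<close> of \<open>I\<close> such that \<open>[X, B] = M\<close> is solvable for every \<open>M\<close>.  The forward shift is
  such an \<open>X\<close>: column \<open>j\<close> of the equation expresses column \<open>j + 1\<close> of \<open>B\<close> by column \<open>j\<close>, so \<open>B\<close> is
  found by recursion.  The same recursion works if the lowest nonzero entry of column \<open>j\<close> of \<open>X\<close> lies
  in row \<open>\<sigma> j\<close> for an injective \<open>\<sigma>\<close> with \<open>j < \<sigma> j\<close> (\<open>ad_hessenberg_surj\<close>).  To find \<open>X\<close>, entries of
  \<open>A\<close> forming an infinite upper triangular pattern are moved by brackets with partial permutation
  matrices to a block with rows in an infinite set \<open>S\<close> and columns in its infinite complement.  In
  increasing enumerations of both, the pattern is placed one row lower, so that its diagonal
  becomes the subdiagonal of the block.  The bracket with a bijection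
  from \<open>S\<close> to its complement then turns this block into a shift-like matrix on the complement
  and its negative on \<open>S\<close>.  No step divides by an integer, so the characteristic of the field
  is arbitrary.
\<close>

section \<open>Products and brackets of column-finite matrices\<close>

lemma imat_mult_eq_sum:
  assumes "finite K" "\<And>k. k \<notin> K \<Longrightarrow> A i k * B k j = 0"
  shows "(A **\<^sub>\<infinity> B) i j = (\<Sum>k\<in>K. A i k * B k j)"
  unfolding imat_mult_def using assms by (intro Sum_any.expand_superset) auto

lemma imat_mult_eq_single:
  assumes "\<And>k. k \<noteq> l \<Longrightarrow> A i k * B k j = 0"
  shows "(A **\<^sub>\<infinity> B) i j = A i l * B l j"
  using imat_mult_eq_sum[of "{l}" A i B j] assms by simp

lemma imat_mult_eq_0:
  assumes "\<And>k. A i k * B k j = 0"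
  shows "(A **\<^sub>\<infinity> B) i j = 0"
  using imat_mult_eq_sum[of "{}" A i B j] assms by simp

lemma lie_bracket_apply:
  "lie_bracket A B i j = (A **\<^sub>\<infinity> B) i j - (B **\<^sub>\<infinity> A) i j"
  by (simp add: lie_bracket_def)

lemma lie_bracket_swap: "lie_bracket A B = - lie_bracket B A"
  by (simp add: lie_bracket_def)

lemma imat_scale_apply: "imat_scale c A i j = c * A i j"
  by (simp add: imat_scale_def)

lemma gl_cf_D: "A \<in> gl_cf \<Longrightarrow> finite {i. A i j \<noteq> 0}"
  by (simp add: gl_cf_def)

lemma imat_mult_right_distrib:
  assumes "B \<in> gl_cf" "C \<in> gl_cf"
  shows "A **\<^sub>\<infinity> (B + C) = A **\<^sub>\<infinity> B + A **\<^sub>\<infinity> C"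
proof (intro ext)
  fix i j
  let ?K = "{k. B k j \<noteq> 0} \<union> {k. C k j \<noteq> 0}"
  have "finite ?K" using assms by (simp add: gl_cf_D)
  moreover have "X \<in> {B, C, B + C} \<Longrightarrow> (A **\<^sub>\<infinity> X) i j = (\<Sum>k\<in>?K. A i k * X k j)" for X
    by (rule imat_mult_eq_sum) (use \<open>finite ?K\<close> in auto)
  ultimately show "(A **\<^sub>\<infinity> (B + C)) i j = (A **\<^sub>\<infinity> B + A **\<^sub>\<infinity> C) i j"
    by (simp add: sum.distrib distrib_left)
qed

lemma imat_mult_left_distrib:
  assumes "A \<in> gl_cf"
  shows "(B + C) **\<^sub>\<infinity> A = B **\<^sub>\<infinity> A + C **\<^sub>\<infinity> A"
proof (intro ext)
  fix i j
  let ?K = "{k. A k j \<noteq> 0}"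
  have "finite ?K" using assms by (simp add: gl_cf_D)
  moreover have "(X **\<^sub>\<infinity> A) i j = (\<Sum>k\<in>?K. X i k * A k j)" for X
    by (rule imat_mult_eq_sum) (use \<open>finite ?K\<close> in auto)
  ultimately show "((B + C) **\<^sub>\<infinity> A) i j = (B **\<^sub>\<infinity> A + C **\<^sub>\<infinity> A) i j"
    by (simp add: sum.distrib distrib_right)
qed

lemma lie_bracket_right_add:
  assumes "A \<in> gl_cf" "B \<in> gl_cf" "C \<in> gl_cf"
  shows "lie_bracket A (B + C) = lie_bracket A B + lie_bracket A C"
  using assms by (simp add: lie_bracket_def imat_mult_left_distrib imat_mult_right_distrib)

lemma imat_mult_gl_cf:
  assumes "A \<in> gl_cf" "B \<in> gl_cf"
  shows "A **\<^sub>\<infinity> B \<in> gl_cf"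
proof -
  have "finite {i. (A **\<^sub>\<infinity> B) i j \<noteq> 0}" for j
  proof (rule finite_subset)
    show "{i. (A **\<^sub>\<infinity> B) i j \<noteq> 0} \<subseteq> (\<Union>k\<in>{k. B k j \<noteq> 0}. {i. A i k \<noteq> 0})"
    proof
      fix i assume "i \<in> {i. (A **\<^sub>\<infinity> B) i j \<noteq> 0}"
      then obtain k where "A i k * B k j \<noteq> 0" using imat_mult_eq_0[of A i B j] by blast
      then show "i \<in> (\<Union>k\<in>{k. B k j \<noteq> 0}. {i. A i k \<noteq> 0})" by auto
    qed
    show "finite (\<Union>k\<in>{k. B k j \<noteq> 0}. {i. A i k \<noteq> 0})"
      using assms by (simp add: gl_cf_D)
  qed
  then show ?thesis by (simp add: gl_cf_def)
qed

lemma subspace_gl_cf: "imat.subspace (gl_cf :: 'k::field imat set)"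
proof (rule imat.subspaceI)
  fix A B :: "'k imat" assume "A \<in> gl_cf" "B \<in> gl_cf"
  then have "finite ({i. A i j \<noteq> 0} \<union> {i. B i j \<noteq> 0})" for j by (simp add: gl_cf_D)
  moreover have "{i. (A + B) i j \<noteq> 0} \<subseteq> {i. A i j \<noteq> 0} \<union> {i. B i j \<noteq> 0}" for j by auto
  ultimately show "A + B \<in> gl_cf" unfolding gl_cf_def using finite_subset by blast
next
  fix c and A :: "'k imat" assume "A \<in> gl_cf"
  then show "imat_scale c A \<in> gl_cf"
    by (auto simp: gl_cf_def imat_scale_apply)
qed (simp add: gl_cf_def)

lemma lie_bracket_gl_cf: "A \<in> gl_cf \<Longrightarrow> B \<in> gl_cf \<Longrightarrow> lie_bracket A B \<in> gl_cf"
  by (simp add: lie_bracket_def imat.subspace_diff[OF subspace_gl_cf] imat_mult_gl_cf)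

section \<open>Matrix units and partial permutation matrices\<close>

text \<open>
  This is the sum of the matrix units \<open>E_(u n, v n)\<close>.  When \<open>u\<close> and \<open>v\<close> are injective, it is a partial
  permutation matrix: multiplication from the left moves row \<open>v n\<close> to row \<open>u n\<close>, multiplication
  from the right moves column \<open>u n\<close> to column \<open>v n\<close>, and all other rows or columns become \<open>0\<close>.
\<close>

definition pairing_matrix :: "(nat \<Rightarrow> nat) \<Rightarrow> (nat \<Rightarrow> nat) \<Rightarrow> 'k::field imat" where
  "pairing_matrix u v = (\<lambda>i j. if \<exists>n. i = u n \<and> j = v n then 1 else 0)"

lemma pairing_matrix_gl_cf:
  assumes "inj v" shows "(pairing_matrix u v :: 'k::field imat) \<in> gl_cf"
proof -
  have "{i. pairing_matrix u v i j \<noteq> (0::'k)} \<subseteq> {u (inv v j)}" for j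
    using assms by (auto simp: pairing_matrix_def)
  then show ?thesis by (auto simp: gl_cf_def intro: finite_subset)
qed

lemma imat_mult_pairing:
  assumes "inj v"
  shows "(A **\<^sub>\<infinity> pairing_matrix u v) i j = (if j \<in> range v then A i (u (inv v j)) else 0)"
proof (cases "j \<in> range v")
  case True
  then obtain n where j: "j = v n" by auto
  have "(A **\<^sub>\<infinity> pairing_matrix u v) i j = A i (u n) * pairing_matrix u v (u n) j"
    by (rule imat_mult_eq_single) (use assms j in \<open>auto simp: pairing_matrix_def inj_eq\<close>)
  then show ?thesis using assms j by (auto simp: pairing_matrix_def)
qed (auto intro!: imat_mult_eq_0 simp: pairing_matrix_def)

lemma pairing_mult_imat:
  assumes "inj u"
  shows "(pairing_matrix u v **\<^sub>\<infinity> A) i j = (if i \<in> range u then A (v (inv u i)) j else 0)"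
proof (cases "i \<in> range u")
  case True
  then obtain n where i: "i = u n" by auto
  have "(pairing_matrix u v **\<^sub>\<infinity> A) i j = pairing_matrix u v i (v n) * A (v n) j"
    by (rule imat_mult_eq_single) (use assms i in \<open>auto simp: pairing_matrix_def inj_eq\<close>)
  then show ?thesis using assms i by (auto simp: pairing_matrix_def)
qed (auto intro!: imat_mult_eq_0 simp: pairing_matrix_def)

lemma imat_unit_gl_cf: "imat_unit p q \<in> gl_cf"
  by (auto simp: gl_cf_def imat_unit_def)

lemma imat_mult_unit: "(A **\<^sub>\<infinity> imat_unit p q) i j = (if j = q then A i p else 0)"
  using imat_mult_eq_single[of p A i "imat_unit p q" j] by (simp add: imat_unit_def)

lemma unit_mult_imat: "(imat_unit p q **\<^sub>\<infinity> A) i j = (if i = p then A q j else 0)"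
  using imat_mult_eq_single[of q "imat_unit p q" i A j] by (simp add: imat_unit_def)
section \<open>Solving a commutator equation column by column\<close>

text \<open>
  In column \<open>j\<close> of \<open>[X, B] = M\<close>, the product \<open>X B\<close> depends on column \<open>j\<close> of \<open>B\<close>, and \<open>B X\<close> is a combination
  of the columns of \<open>B\<close> up to \<open>\<sigma> j\<close>, the last one with the invertible coefficient \<open>X (\<sigma> j) j\<close>.  So
  the equation determines column \<open>\<sigma> j\<close> from earlier ones.  As \<open>\<sigma>\<close> is injective, at most
  one such equation is imposed on each column of \<open>B\<close>.
\<close>

lemma ad_hessenberg_surj:
  fixes X M :: "'k::field imat"
  assumes X: "X \<in> gl_cf" and M: "M \<in> gl_cf"
    and inj: "inj \<sigma>" and less: "\<And>j. j < \<sigma> j"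
    and pivot: "\<And>j. X (\<sigma> j) j \<noteq> 0" and below: "\<And>i j. \<sigma> j < i \<Longrightarrow> X i j = 0"
  obtains B where "B \<in> gl_cf" "lie_bracket X B = M"
proof -
  \<comment> \<open>\<open>P b k r\<close>: given the earlier columns \<open>b\<close>, the vector \<open>r\<close> is a valid column \<open>k\<close>.\<close>
  define P where "P = (\<lambda>(b :: nat \<Rightarrow> nat \<Rightarrow> 'k) k r. finite {i. r i \<noteq> 0} \<and>
    (\<forall>j. \<sigma> j = k \<longrightarrow> (\<forall>i. r i * X k j =
       Sum_any (\<lambda>l. X i l * b j l) - M i j - (\<Sum>l<k. b l i * X l j))))"
  \<comment> \<open>Validity refers to earlier columns only, so the columns can be chosen by well-founded recursion.\<close>
  have "\<exists>b. \<forall>k. P b k (b k)"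
  proof (rule dependent_wellorder_choice)
    fix r and f g :: "nat \<Rightarrow> nat \<Rightarrow> 'k" and k
    assume "\<And>y. y < k \<Longrightarrow> f y = g y"
    then show "P f k r = P g k r"
      unfolding P_def using less by (auto simp: fun_eq_iff)
  next
    fix k and b :: "nat \<Rightarrow> nat \<Rightarrow> 'k"
    assume IH: "\<And>y. y < k \<Longrightarrow> P b y (b y)"
    show "\<exists>r. P b k r"
    proof (cases "k \<in> range \<sigma>")
      case False
      then show ?thesis by (intro exI[of _ "\<lambda>_. 0"]) (auto simp: P_def)
    next
      case True
      then obtain j where k: "k = \<sigma> j" by auto
      have fin: "finite {i. b l i \<noteq> 0}" if "l < k" for l
        using IH[OF that] by (simp add: P_def)
      define r where "r = (\<lambda>i. (Sum_any (\<lambda>l. X i l * b j l) - M i j - (\<Sum>l<k. b l i * X l j)) / X k j)"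
      have "{i. r i \<noteq> 0} \<subseteq> (\<Union>l\<in>{l. b j l \<noteq> 0}. {i. X i l \<noteq> 0}) \<union> {i. M i j \<noteq> 0}
          \<union> (\<Union>l<k. {i. b l i \<noteq> 0})" (is "_ \<subseteq> ?R")
      proof
        fix i assume "i \<in> {i. r i \<noteq> 0}"
        moreover have "r i = 0" if "i \<notin> ?R"
        proof -
          have "X i l * b j l = 0" for l using that by auto
          then have "Sum_any (\<lambda>l. X i l * b j l) = 0" by (simp del: mult_eq_0_iff)
          moreover have "(\<Sum>l<k. b l i * X l j) = 0" using that by (intro sum.neutral) auto
          ultimately show ?thesis using that by (simp add: r_def)
        qed
        ultimately show "i \<in> ?R" by blast
      qed
      moreover have "finite ?R"
        using fin less[of j] X M k by (auto simp: gl_cf_D)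
      ultimately have "finite {i. r i \<noteq> 0}" by (rule finite_subset)
      moreover have "r i * X k j' = Sum_any (\<lambda>l. X i l * b j' l) - M i j' - (\<Sum>l<k. b l i * X l j')"
        if "\<sigma> j' = k" for i j'
      proof -
        have "j' = j" using that k inj by (simp add: inj_eq)
        then show ?thesis using pivot[of j] k by (simp add: r_def)
      qed
      ultimately have "P b k r" unfolding P_def by blast
      then show ?thesis by blast
    qed
  qed
  then obtain b where b: "\<And>k. P b k (b k)" by blast
  define B where "B = (\<lambda>i k. b k i)"
  have "B \<in> gl_cf" using b by (auto simp: gl_cf_def B_def P_def)
  moreover have "lie_bracket X B = M"
  proof (intro ext)
    fix i j
    have "(B **\<^sub>\<infinity> X) i j = (\<Sum>l\<le>\<sigma> j. b l i * X l j)"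
      unfolding B_def by (rule imat_mult_eq_sum) (use below in auto)
    also have "\<dots> = b (\<sigma> j) i * X (\<sigma> j) j + (\<Sum>l<\<sigma> j. b l i * X l j)"
      by (simp add: lessThan_Suc_atMost[symmetric])
    also have "\<dots> = Sum_any (\<lambda>l. X i l * b j l) - M i j"
      using b[of "\<sigma> j"] by (simp add: P_def)
    finally show "lie_bracket X B i j = M i j"
      by (simp add: lie_bracket_apply) (simp add: imat_mult_def B_def)
  qed
  ultimately show ?thesis by (rule that)
qed

section \<open>Ideals that are not contained in the scalar plus finite-row matrices\<close>

text \<open>
  The pairs are chosen one after the other.  As the columns are finite, there is a bound \<open>b\<close> that
  exceeds the indices chosen so far and all nonzero rows of the columns with these indices; the next
  row index is at least \<open>b\<close>.  This makes the new column index differ from all earlier indices as well,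
  since the entry of \<open>A\<close> at the new position is nonzero.
\<close>

lemma offdiagonal_staircase:
  fixes A :: "'k::field imat"
  assumes A: "A \<in> gl_cf" and inf: "infinite {i. \<exists>j. j \<noteq> i \<and> A i j \<noteq> 0}"
  obtains p q :: "nat \<Rightarrow> nat" where "strict_mono p" "inj q" "\<And>m n. p m \<noteq> q n"
    "\<And>n. A (p n) (q n) \<noteq> 0" "\<And>m n. n < m \<Longrightarrow> A (p m) (q n) = 0"
proof -
  \<comment> \<open>A state is a chosen position together with such a bound for it.\<close>
  define P where "P = (\<lambda>(p, q, b). A p q \<noteq> 0 \<and> p \<noteq> q \<and> p < b \<and> q < b \<and>
    (\<forall>i\<ge>b. A i p = 0 \<and> A i q = 0))"
  have step: "\<exists>p q b'. P (p, q, b') \<and> b \<le> p \<and> b \<le> b'" for b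
  proof -
    obtain p where p: "b \<le> p" "p \<in> {i. \<exists>j. j \<noteq> i \<and> A i j \<noteq> 0}"
      using inf unfolding infinite_nat_iff_unbounded_le by blast
    then obtain q where q: "q \<noteq> p" "A p q \<noteq> 0" by auto
    have "finite ({i. A i p \<noteq> 0} \<union> {i. A i q \<noteq> 0} \<union> {p, q, b})" using A by (simp add: gl_cf_D)
    then obtain c where c: "\<forall>i \<in> {i. A i p \<noteq> 0} \<union> {i. A i q \<noteq> 0} \<union> {p, q, b}. i < c"
      unfolding finite_nat_set_iff_bounded by blast
    then have "A i p = 0" "A i q = 0" if "c \<le> i" for i
      using that by (auto simp: not_le[symmetric])
    then have "P (p, q, c) \<and> b \<le> p \<and> b \<le> c" using p q c by (auto simp: P_def)
    then show ?thesis by blast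
  qed
  have "\<exists>f. \<forall>n. P (f n) \<and> (snd (snd (f n)) \<le> fst (f (Suc n)) \<and> snd (snd (f n)) \<le> snd (snd (f (Suc n))))"
    by (rule dependent_nat_choice) (use step in \<open>force\<close>)+
  then obtain f where f: "\<And>n. P (f n)" "\<And>n. snd (snd (f n)) \<le> fst (f (Suc n))"
    "\<And>n. snd (snd (f n)) \<le> snd (snd (f (Suc n)))" by blast
  define p where "p n = fst (f n)" for n
  define q where "q n = fst (snd (f n))" for n
  define b where "b n = snd (snd (f n))" for n
  have P: "A (p n) (q n) \<noteq> 0" "p n \<noteq> q n" "p n < b n" "q n < b n"
    "\<And>i. b n \<le> i \<Longrightarrow> A i (p n) = 0" "\<And>i. b n \<le> i \<Longrightarrow> A i (q n) = 0" for n
    using f(1)[of n] by (auto simp: P_def p_def q_def b_def split: prod.splits)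
  have "mono b" using f(3) by (simp add: mono_iff_le_Suc b_def)
  \<comment> \<open>Columns \<open>p n\<close> and \<open>q n\<close> vanish from row \<open>b n\<close> on, in particular in all later rows \<open>p m\<close>.\<close>
  have bp: "b n \<le> p m" if nm: "n < m" for m n
  proof -
    obtain m' where m: "m = Suc m'" using nm by (cases m) auto
    then have "b n \<le> b m'" using \<open>mono b\<close> that by (simp add: monoD)
    also have "\<dots> \<le> p m" using f(2) m by (simp add: b_def p_def)
    finally show ?thesis .
  qed
  have sep: "A (p m) (q n) = 0" "q m \<noteq> q n" "p m \<noteq> q n" "p n \<noteq> q m" "p n < p m" if "n < m" for m n
    using bp[OF that] P[of n] P[of m] by (auto simp: order.strict_trans2)
  show ?thesis
  proof (rule that[of p q])
    show "strict_mono p" using sep(5) by (simp add: strict_mono_def)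
    show "inj q" using sep(2) by (metis injI linorder_neqE_nat)
    show "p m \<noteq> q n" for m n using sep(3,4) P(2) by (metis linorder_neqE_nat)
  qed (use P sep in auto)
qed

lemma lie_ideal_subset: "lie_ideal I \<Longrightarrow> A \<in> I \<Longrightarrow> A \<in> gl_cf"
  by (auto simp: lie_ideal_def)

lemma lie_ideal_subspace: "lie_ideal I \<Longrightarrow> imat.subspace I"
  by (simp add: lie_ideal_def)

lemma lie_ideal_bracket_left:
  "lie_ideal I \<Longrightarrow> A \<in> gl_cf \<Longrightarrow> B \<in> I \<Longrightarrow> lie_bracket A B \<in> I"
  by (simp add: lie_ideal_def)

lemma lie_ideal_bracket_right:
  "lie_ideal I \<Longrightarrow> A \<in> I \<Longrightarrow> B \<in> gl_cf \<Longrightarrow> lie_bracket A B \<in> I"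
  by (subst lie_bracket_swap) (simp add: lie_ideal_def imat.subspace_neg)

lemma lie_ideal_scale_cancel:
  assumes "lie_ideal I" "imat_scale c A \<in> I" "c \<noteq> 0"
  shows "A \<in> I"
  using imat.subspace_scale[OF lie_ideal_subspace[OF assms(1)] assms(2), of "inverse c"] assms(3)
  by simp

text \<open>
  The triangular pattern uses the even-numbered staircase positions; the odd-numbered rows are
  kept free and form the infinite set \<open>S = range x\<close>, whose complement is enumerated by \<open>z\<close>.  With \<open>X1\<close>
  sending row \<open>p (2 m)\<close> to row \<open>x (m + 1)\<close> and \<open>Y1\<close> sending column \<open>q (2 n)\<close> to column \<open>z n\<close>, both
  \<open>X1 Y1\<close> and \<open>Y1 X1\<close> vanish, so \<open>[[X1, A], Y1] = X1 A Y1 + Y1 A X1\<close>.  The second summand has rows and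
  columns outside \<open>S\<close>, so the bracket with the projection to \<open>S\<close> leaves \<open>V = X1 A Y1\<close>.  Finally,
  for \<open>C\<close> sending \<open>x n\<close> to \<open>z n\<close>, the matrix \<open>[C, V]\<close> is block diagonal with the blocks \<open>C V\<close> on the
  complement of \<open>S\<close> and \<open>- V C\<close> on \<open>S\<close>.
\<close>

lemma lie_ideal_eq_gl_cf_if_offdiagonal:
  fixes A :: "'k::field imat"
  assumes I: "lie_ideal I" and A: "A \<in> I" and inf: "infinite {i. \<exists>j. j \<noteq> i \<and> A i j \<noteq> 0}"
  shows "I = gl_cf"
proof -
  obtain p q :: "nat \<Rightarrow> nat" where p: "strict_mono p" and q: "inj q" and pq: "\<And>m n. p m \<noteq> q n"
    and pivot: "\<And>n. A (p n) (q n) \<noteq> 0" and below: "\<And>m n. n < m \<Longrightarrow> A (p m) (q n) = 0"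
    using offdiagonal_staircase[OF lie_ideal_subset[OF I A] inf] by blast
  have inj_p: "inj p" using p by (rule strict_mono_imp_inj_on)
  define x where "x n = p (2 * n + 1)" for n
  define z where "z = enumerate (- range x)"
  have p_notin: "p (2 * n) \<notin> range x" for n
    using inj_p by (auto simp: x_def inj_eq) presburger
  have q_notin: "q n \<notin> range x" for n
    using pq by (auto simp: x_def) metis
  have x_ne: "x m \<noteq> p (2 * n)" "x m \<noteq> q n" for m n
    using p_notin[of n] q_notin[of n] by (metis rangeI)+
  have "range (\<lambda>n. p (2 * n)) \<subseteq> - range x" using p_notin by auto
  moreover have "infinite (range (\<lambda>n. p (2 * n)))"
    by (rule range_inj_infinite) (auto intro!: injI simp: inj_eq[OF inj_p])
  ultimately have infz: "infinite (- range x)" using finite_subset by blast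
  have x: "strict_mono x" using p by (auto simp: strict_mono_def x_def)
  have z: "strict_mono z" unfolding z_def by (rule strict_mono_enumerate[OF infz])
  have range_z: "range z = - range x" unfolding z_def by (rule range_enumerate[OF infz])
  have inj: "inj x" "inj z" "inj (x \<circ> Suc)" "inj (\<lambda>n. p (2 * n))" "inj (\<lambda>n. q (2 * n))"
    using x z by (auto intro!: injI simp: inj_eq[OF inj_p] inj_eq[OF q] strict_mono_eq)
  have xz: "x m \<noteq> z n" "z n \<noteq> x m" for m n using range_z by blast+
  have cases: "\<exists>n. i = x n \<or> i = z n" for i using range_z by blast

  define X1 :: "'k imat" where "X1 = pairing_matrix (x \<circ> Suc) (\<lambda>n. p (2 * n))"
  define Y1 :: "'k imat" where "Y1 = pairing_matrix (\<lambda>n. q (2 * n)) z"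
  define G where "G = lie_bracket X1 A"
  define W where "W = lie_bracket G Y1"
  define V where "V = lie_bracket (pairing_matrix x x) W"
  define X where "X = lie_bracket (pairing_matrix z x) V"
  have "X \<in> I" unfolding X_def V_def W_def G_def X1_def Y1_def using inj
    by (intro lie_ideal_bracket_left[OF I] lie_ideal_bracket_right[OF I] A pairing_matrix_gl_cf)

  have G: "G (x (Suc m)) (q n) = A (p (2 * m)) (q n)" "G (x 0) (q n) = 0" "G (z m) (x n) = 0"
     for m n
  proof -
    have q': "q n \<notin> range (\<lambda>n. p (2 * n))" using pq[THEN not_sym] by auto
    have "x (Suc m) \<in> range (x \<circ> Suc)" "inv (x \<circ> Suc) (x (Suc m)) = m"
      using inv_f_f[OF inj(3), of m] by auto
    moreover have "x 0 \<notin> range (x \<circ> Suc)" using inj(1) by (auto simp: inj_eq)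
    moreover have "z m \<notin> range (x \<circ> Suc)" using xz by auto
    moreover have "x n \<notin> range (\<lambda>n. p (2 * n))" using x_ne by auto
    ultimately show "G (x (Suc m)) (q n) = A (p (2 * m)) (q n)" "G (x 0) (q n) = 0" "G (z m) (x n) = 0"
      using q' inj unfolding G_def X1_def lie_bracket_apply
      by (simp_all only: imat_mult_pairing pairing_mult_imat) simp_all
  qed
  have W: "W (x m) (z n) = G (x m) (q (2 * n))" "W (z m) (x n) = 0" for m n
  proof -
    have "x m \<notin> range (\<lambda>n. q (2 * n))" using x_ne by auto
    moreover have "x n \<notin> range z" using range_z by auto
    moreover have "(Y1 **\<^sub>\<infinity> G) (z m) (x n) = 0"
    proof (cases "z m \<in> range (\<lambda>n. q (2 * n))")
      case True
      then show ?thesis using inj G(3) by (simp add: Y1_def pairing_mult_imat)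
    qed (use inj in \<open>simp add: Y1_def pairing_mult_imat\<close>)
    ultimately show "W (x m) (z n) = G (x m) (q (2 * n))" "W (z m) (x n) = 0"
      using inj unfolding W_def lie_bracket_apply
      by (simp_all add: Y1_def imat_mult_pairing pairing_mult_imat)
  qed
  have z_notin: "z n \<notin> range x" for n using range_z by blast
  have V: "V (x (Suc m)) (z n) = A (p (2 * m)) (q (2 * n))" "V (x 0) (z n) = 0"
    "V (z m) (z n) = 0" "V (z m) (x n) = 0" "V (x m) (x n) = 0" for m n
    using inj z_notin G W unfolding V_def lie_bracket_apply
    by (simp_all add: imat_mult_pairing pairing_mult_imat)
  have X: "X (z m) (z n) = V (x m) (z n)" "X (x m) (x n) = - V (x m) (z n)"
    "X (x m) (z n) = 0" "X (z m) (x n) = 0" for m n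
    using inj z_notin V xz range_z unfolding X_def lie_bracket_apply
    by (simp_all add: imat_mult_pairing pairing_mult_imat)

  \<comment> \<open>The shift \<open>x m\<close> to \<open>x (m + 1)\<close> built into \<open>X1\<close> is what makes \<open>\<sigma>\<close> strictly increase every index.\<close>
  define \<sigma> where "\<sigma> j = (if j \<in> range x then x (Suc (inv x j)) else z (Suc (inv z j)))" for j
  have \<sigma>: "\<sigma> (x n) = x (Suc n)" "\<sigma> (z n) = z (Suc n)" for n
    using inj z_notin by (auto simp: \<sigma>_def)
  have "inj \<sigma>"
  proof (rule injI)
    fix i j assume "\<sigma> i = \<sigma> j"
    with cases[of i] cases[of j] show "i = j"
      using \<sigma> xz inj by (auto simp: inj_eq)
  qed
  moreover have "j < \<sigma> j" for j
    using cases[of j] \<sigma> x z by (auto simp: strict_mono_less)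
  moreover have "X (\<sigma> j) j \<noteq> 0" for j
    using cases[of j] \<sigma> X V pivot by auto
  moreover have "X i j = 0" if "\<sigma> j < i" for i j
  proof -
    have V0: "V (x m) (z n) = 0" if "Suc n < m" for m n
      using that V(1)[of "m - 1" n] below[of "2 * n" "2 * (m - 1)"] by auto
    show ?thesis using cases[of i] cases[of j] \<sigma> X V0 that x z
      by (auto simp: strict_mono_less)
  qed
  moreover have "X \<in> gl_cf" using \<open>X \<in> I\<close> lie_ideal_subset[OF I] by blast
  ultimately have "M \<in> I" if "M \<in> gl_cf" for M
    using ad_hessenberg_surj[of X M \<sigma>] lie_ideal_bracket_right[OF I \<open>X \<in> I\<close>] that by metis
  then show ?thesis using lie_ideal_subset[OF I] by blast
qed

text \<open>
  If the off-diagonal part of \<open>A\<close> has infinitely many nonzero rows, the previous lemma applies.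
  Otherwise \<open>A\<close> is diagonal up to finitely many rows, and its diagonal is not eventually constant
  since \<open>A\<close> is not scalar modulo \<open>gl_fr\<close>.  In all but finitely many rows, the bracket with the
  shift has differences of neighbouring diagonal entries of \<open>A\<close> just below the diagonal, and
  infinitely many of these are nonzero.
\<close>

lemma lie_ideal_eq_gl_cf:
  fixes A :: "'k::field imat"
  assumes I: "lie_ideal I" and A: "A \<in> I" and nonscalar: "A \<notin> d_sc + gl_fr"
  shows "I = gl_cf"
proof (cases "finite {i. \<exists>j. j \<noteq> i \<and> A i j \<noteq> 0}")
  case False
  then show ?thesis using lie_ideal_eq_gl_cf_if_offdiagonal[OF I A] by simp
next
  case True
  have A_cf: "A \<in> gl_cf" using lie_ideal_subset[OF I A] .
  obtain N where N: "\<And>i j. N \<le> i \<Longrightarrow> j \<noteq> i \<Longrightarrow> A i j = 0"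
    using True unfolding finite_nat_set_iff_bounded by (auto simp: not_le[symmetric])
  have jumps: "\<exists>n\<ge>m. A n n \<noteq> A (Suc n) (Suc n)" for m
  proof (rule ccontr)
    assume *: "\<not> ?thesis"
    have const: "A n n = A m m" if "m \<le> n" for n
      using that
    proof (induction n rule: dec_induct)
      case (step n)
      then show ?case using * by metis
    qed simp
    define D where "D = A - imat_scale (A m m) imat_id"
    have "imat_scale (A m m) imat_id \<in> gl_cf"
      by (auto simp: gl_cf_def imat_scale_apply imat_id_def)
    then have "D \<in> gl_cf"
      unfolding D_def using A_cf by (intro imat.subspace_diff subspace_gl_cf)
    moreover have "D i j = 0" if "max m N \<le> i" for i j
      using that const[of i] N[of i j] by (cases "j = i") (auto simp: D_def imat_scale_apply imat_id_def)
    then have "{i. \<exists>j. D i j \<noteq> 0} \<subseteq> {..<max m N}" by (auto simp: not_le[symmetric] simp del: max.bounded_iff)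
    then have "finite {i. \<exists>j. D i j \<noteq> 0}" using finite_subset by blast
    ultimately have "D \<in> gl_fr" by (simp add: gl_fr_def)
    moreover have "A = imat_scale (A m m) imat_id + D" by (simp add: D_def)
    moreover have "imat_scale (A m m) imat_id \<in> d_sc" by (auto simp: d_sc_def)
    ultimately have "A \<in> d_sc + gl_fr" by (metis set_plus_intro)
    then show False using nonscalar by simp
  qed
  define T :: "'k imat" where "T = pairing_matrix Suc id"
  have "lie_bracket T A \<in> I"
    unfolding T_def by (intro lie_ideal_bracket_left[OF I] A pairing_matrix_gl_cf) simp
  moreover have "infinite {i. \<exists>j. j \<noteq> i \<and> lie_bracket T A i j \<noteq> 0}"
    unfolding infinite_nat_iff_unbounded_le
  proof
    fix m
    obtain n where n: "m \<le> n" "A n n \<noteq> A (Suc n) (Suc n)" using jumps by blast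
    have "inv Suc (Suc n) = n" by (simp add: inv_f_f)
    then have "lie_bracket T A (Suc n) n = A n n - A (Suc n) (Suc n)"
      by (simp add: lie_bracket_apply T_def imat_mult_pairing pairing_mult_imat)
    then show "\<exists>i\<ge>m. i \<in> {i. \<exists>j. j \<noteq> i \<and> lie_bracket T A i j \<noteq> 0}"
      using n by (intro exI[of _ "Suc n"]) (auto intro!: exI[of _ n])
  qed
  ultimately show ?thesis by (rule lie_ideal_eq_gl_cf_if_offdiagonal[OF I])
qed

section \<open>Finite-row matrices and the trace\<close>

lemma imat_trace_eq_sum:
  assumes "finite F" "\<And>i. i \<notin> F \<Longrightarrow> A i i = 0"
  shows "imat_trace A = (\<Sum>i\<in>F. A i i)"
  unfolding imat_trace_def using assms by (intro Sum_any.expand_superset) auto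

lemma gl_fr_rows:
  assumes "A \<in> gl_fr"
  obtains F where "finite F" "\<And>i j. i \<notin> F \<Longrightarrow> A i j = 0"
proof (rule that[of "{i. \<exists>j. A i j \<noteq> 0}"])
  show "finite {i. \<exists>j. A i j \<noteq> 0}" using assms by (simp add: gl_fr_def)
qed auto

lemma gl_fr_I:
  assumes "A \<in> gl_cf" "finite F" "\<And>i j. i \<notin> F \<Longrightarrow> A i j = 0"
  shows "A \<in> gl_fr"
proof -
  have "{i. \<exists>j. A i j \<noteq> 0} \<subseteq> F" using assms(3) by auto
  then show ?thesis using assms finite_subset by (auto simp: gl_fr_def)
qed

lemma subspace_gl_fr: "imat.subspace (gl_fr :: 'k::field imat set)"
proof (rule imat.subspaceI)
  show "(0 :: 'k imat) \<in> gl_fr"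
    by (rule gl_fr_I[of _ "{}"]) (auto simp: imat.subspace_0[OF subspace_gl_cf])
next
  fix A B :: "'k imat" assume A: "A \<in> gl_fr" and B: "B \<in> gl_fr"
  obtain F G where "finite F" "\<And>i j. i \<notin> F \<Longrightarrow> A i j = 0" "finite G" "\<And>i j. i \<notin> G \<Longrightarrow> B i j = 0"
    using gl_fr_rows[OF A] gl_fr_rows[OF B] by metis
  moreover have "A + B \<in> gl_cf" using A B by (auto simp: gl_fr_def imat.subspace_add[OF subspace_gl_cf])
  ultimately show "A + B \<in> gl_fr" by (intro gl_fr_I[of _ "F \<union> G"]) auto
next
  fix c and A :: "'k imat" assume A: "A \<in> gl_fr"
  obtain F where "finite F" "\<And>i j. i \<notin> F \<Longrightarrow> A i j = 0" using gl_fr_rows[OF A] by metis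
  moreover have "imat_scale c A \<in> gl_cf"
    using A by (auto simp: gl_fr_def imat.subspace_scale[OF subspace_gl_cf])
  ultimately show "imat_scale c A \<in> gl_fr" by (intro gl_fr_I[of _ F]) (auto simp: imat_scale_apply)
qed

lemma imat_trace_add:
  assumes "A \<in> gl_fr" "B \<in> gl_fr"
  shows "imat_trace (A + B) = imat_trace A + imat_trace B"
proof -
  obtain F G where F: "finite F" "\<And>i j. i \<notin> F \<Longrightarrow> A i j = 0"
      and G: "finite G" "\<And>i j. i \<notin> G \<Longrightarrow> B i j = 0"
    using gl_fr_rows[OF assms(1)] gl_fr_rows[OF assms(2)] by metis
  have "imat_trace M = (\<Sum>i\<in>F \<union> G. M i i)" if "M \<in> {A, B, A + B}" for M
    using that F G by (intro imat_trace_eq_sum) auto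
  then show ?thesis by (simp add: sum.distrib)
qed

lemma imat_trace_scale:
  assumes "A \<in> gl_fr"
  shows "imat_trace (imat_scale c A) = c * imat_trace A"
proof -
  obtain F where F: "finite F" "\<And>i j. i \<notin> F \<Longrightarrow> A i j = 0"
    using gl_fr_rows[OF assms] by metis
  have "imat_trace M = (\<Sum>i\<in>F. M i i)" if "M \<in> {A, imat_scale c A}" for M
    using that F by (intro imat_trace_eq_sum) (auto simp: imat_scale_apply)
  then show ?thesis by (simp add: imat_scale_apply sum_distrib_left)
qed

lemma subspace_sl_fr: "imat.subspace (sl_fr :: 'k::field imat set)"
proof (rule imat.subspaceI)
  show "(0 :: 'k imat) \<in> sl_fr"
    by (simp add: sl_fr_def imat.subspace_0[OF subspace_gl_fr] imat_trace_def)
qed (simp_all add: sl_fr_def imat_trace_add imat_trace_scale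
      imat.subspace_add[OF subspace_gl_fr] imat.subspace_scale[OF subspace_gl_fr])

text \<open>
  Let \<open>F\<close> be the set of nonzero rows of \<open>B\<close>.  All entries of \<open>A\<close> and \<open>B\<close> that contribute to a
  diagonal entry of \<open>A B\<close> or \<open>B A\<close> have their indices in the finite set \<open>H\<close> made of \<open>F\<close> and the nonzero
  rows of the columns of \<open>A\<close> indexed by \<open>F\<close>.  So the usual exchange of two finite sums applies.
\<close>

lemma lie_bracket_gl_fr_in_sl_fr:
  assumes A: "A \<in> gl_cf" and B: "B \<in> gl_fr"
  shows "lie_bracket A B \<in> sl_fr"
proof -
  obtain F where F: "finite F" "\<And>i j. i \<notin> F \<Longrightarrow> B i j = 0" using gl_fr_rows[OF B] by metis
  define H where "H = F \<union> (\<Union>k\<in>F. {i. A i k \<noteq> 0})"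
  have H: "finite H" using F A by (simp add: H_def gl_cf_D)
  have AH: "A i k = 0" if "i \<notin> H" "k \<in> F" for i k using that by (auto simp: H_def)
  have AB: "(A **\<^sub>\<infinity> B) i j = (\<Sum>k\<in>H. A i k * B k j)" for i j
    using H F by (intro imat_mult_eq_sum) (auto simp: H_def)
  have BA: "(B **\<^sub>\<infinity> A) i i = (\<Sum>k\<in>H. B i k * A k i)" for i
  proof (rule imat_mult_eq_sum[OF H])
    show "B i k * A k i = 0" if "k \<notin> H" for k
      using that AH[of k i] F(2)[of i] by (cases "i \<in> F") auto
  qed
  have outside: "lie_bracket A B i j = 0" if "i \<notin> H" for i j
  proof -
    have "(A **\<^sub>\<infinity> B) i j = 0" using AH[OF that] F(2) by (intro imat_mult_eq_0) (metis mult_eq_0_iff)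
    moreover have "(B **\<^sub>\<infinity> A) i j = 0" using F(2) that by (intro imat_mult_eq_0) (auto simp: H_def)
    ultimately show ?thesis by (simp add: lie_bracket_apply)
  qed
  have "lie_bracket A B \<in> gl_fr"
    using A B outside H by (intro gl_fr_I lie_bracket_gl_cf) (auto simp: gl_fr_def)
  moreover have "imat_trace (lie_bracket A B) =
      (\<Sum>i\<in>H. \<Sum>k\<in>H. A i k * B k i) - (\<Sum>i\<in>H. \<Sum>k\<in>H. B i k * A k i)"
    using imat_trace_eq_sum[OF H, of "lie_bracket A B"] outside
    by (simp add: lie_bracket_apply AB BA sum_subtractf)
  moreover have "(\<Sum>i\<in>H. \<Sum>k\<in>H. A i k * B k i) = (\<Sum>i\<in>H. \<Sum>k\<in>H. B i k * A k i)"
    by (subst sum.swap) (simp add: mult.commute)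
  ultimately show ?thesis by (simp add: sl_fr_def)
qed

lemma d_sc_eq_span: "d_sc = imat.span {imat_id}"
  by (auto simp: d_sc_def imat.span_singleton)

lemma J_line_eq_span: "J_line k = imat.span {imat_id + imat_scale k (imat_unit 0 0)}"
  by (auto simp: J_line_def imat.span_singleton)

lemma J_line_0: "J_line 0 = d_sc"
  by (simp add: J_line_eq_span d_sc_eq_span)

lemma subspace_set_plus:
  assumes "imat.subspace U" "imat.subspace W"
  shows "imat.subspace (U + W)"
proof -
  have "U + W = {x + y |x y. x \<in> U \<and> y \<in> W}" by (auto simp: set_plus_def)
  then show ?thesis using imat.subspace_sums[OF assms] by simp
qed

lemma set_plus_subset_subspace:
  assumes "imat.subspace S" "U \<subseteq> S" "W \<subseteq> S"
  shows "U + W \<subseteq> S"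
  using assms by (auto simp: set_plus_def intro!: imat.subspace_add)

lemma subset_set_plus:
  assumes "imat.subspace U" "imat.subspace W"
  shows "U \<subseteq> U + W" "W \<subseteq> U + W"
  using set_plus_intro[of _ U 0 W] set_plus_intro[of 0 U _ W] imat.subspace_0 assms by fastforce+

lemma imat_id_gl_cf: "imat_id \<in> gl_cf"
  by (simp add: gl_cf_def imat_id_def)

lemma d_sc_gl_cf: "d_sc \<subseteq> gl_cf"
  unfolding d_sc_eq_span by (rule imat.span_minimal) (simp_all add: imat_id_gl_cf subspace_gl_cf)

lemma lie_bracket_scalar:
  assumes "Z \<in> d_sc" shows "lie_bracket A Z = 0"
proof (intro ext)
  fix i j
  obtain a where Z: "Z = (\<lambda>i j. if i = j then a else 0)"
    using assms by (auto simp: d_sc_def imat_scale_def imat_id_def fun_eq_iff)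
  have "(A **\<^sub>\<infinity> Z) i j = A i j * a" using imat_mult_eq_single[of j A i Z j] by (simp add: Z)
  moreover have "(Z **\<^sub>\<infinity> A) i j = a * A i j" using imat_mult_eq_single[of i Z i A j] by (simp add: Z)
  ultimately show "lie_bracket A Z i j = 0 i j" by (simp add: lie_bracket_apply mult.commute)
qed

lemma lie_ideal_between:
  fixes U :: "'k::field imat set"
  assumes "imat.subspace U" "sl_fr \<subseteq> U" "U \<subseteq> d_sc + gl_fr"
  shows "lie_ideal U"
proof -
  have fr: "gl_fr \<subseteq> gl_cf" by (auto simp: gl_fr_def)
  have "lie_bracket A B \<in> U" if "A \<in> gl_cf" "B \<in> U" for A B
  proof -
    obtain Z C where B: "B = Z + C" "Z \<in> d_sc" "C \<in> gl_fr"
      using \<open>B \<in> U\<close> assms(3) by (auto simp: set_plus_def)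
    have "lie_bracket A B = lie_bracket A C"
      using B that d_sc_gl_cf fr lie_bracket_scalar[of Z A]
      by (subst B(1), subst lie_bracket_right_add) auto
    then show ?thesis using lie_bracket_gl_fr_in_sl_fr[OF that(1) B(3)] assms(2) by auto
  qed
  moreover have "U \<subseteq> gl_cf"
    using assms(3) set_plus_subset_subspace[OF subspace_gl_cf d_sc_gl_cf fr] by blast
  ultimately show ?thesis using assms(1) by (simp add: lie_ideal_def)
qed

lemma unit_gl_fr: "imat_unit 0 0 \<in> gl_fr"
  by (rule gl_fr_I[of _ "{0}"]) (simp_all add: imat_unit_gl_cf, simp add: imat_unit_def)

lemma imat_trace_unit: "imat_trace (imat_unit 0 0) = 1"
  using imat_trace_eq_sum[of "{0}" "imat_unit 0 0"] by (simp add: imat_unit_def)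

lemma gl_fr_minus_trace_in_sl_fr:
  assumes "B \<in> gl_fr"
  shows "B - imat_scale (imat_trace B) (imat_unit 0 0) \<in> sl_fr"
proof -
  let ?C = "imat_scale (- imat_trace B) (imat_unit 0 0)"
  have C: "?C \<in> gl_fr" by (rule imat.subspace_scale[OF subspace_gl_fr unit_gl_fr])
  have "imat_trace (B + ?C) = 0"
    unfolding imat_trace_add[OF assms C] imat_trace_scale[OF unit_gl_fr] imat_trace_unit by simp
  moreover have "B + ?C \<in> gl_fr" using assms C by (rule imat.subspace_add[OF subspace_gl_fr])
  ultimately have "B + ?C \<in> sl_fr" by (simp only: sl_fr_def mem_Collect_eq)
  then show ?thesis by simp
qed

section \<open>Ideals with a non-scalar element\<close>

text \<open>
  For \<open>q \<noteq> p\<close> and \<open>t \<noteq> i\<close> one has \<open>[[E_ip, A], E_qt] = A_pq E_it + A_ti E_qp\<close>.  As column \<open>i\<close> of \<open>A\<close> is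
  finite, \<open>t\<close> can be chosen with \<open>A_ti = 0\<close>.  The more common double bracket with a single
  \<open>E_qp\<close> gives \<open>- 2 A_pq E_qp\<close>, which is \<open>0\<close> in characteristic \<open>2\<close>.
\<close>

lemma lie_ideal_unit_if_offdiagonal:
  fixes A :: "'k::field imat"
  assumes I: "lie_ideal I" and A: "A \<in> I" and pq: "p \<noteq> q" "A p q \<noteq> 0"
  obtains t where "t \<noteq> i" "imat_unit i t \<in> I"
proof -
  have "finite (insert i {t. A t i \<noteq> 0})" using lie_ideal_subset[OF I A] by (simp add: gl_cf_D)
  then obtain t where t: "t \<noteq> i" "A t i = 0"
    using ex_new_if_finite[of "insert i {t. A t i \<noteq> 0}"] infinite_UNIV_nat by auto
  let ?B = "lie_bracket (lie_bracket (imat_unit i p) A) (imat_unit q t)"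
  have "?B = imat_scale (A p q) (imat_unit i t)"
    using t pq
    by (auto simp: fun_eq_iff lie_bracket_apply imat_mult_unit unit_mult_imat imat_scale_apply)
      (auto simp: imat_unit_def)
  moreover have "?B \<in> I"
    by (intro lie_ideal_bracket_right[OF I] lie_ideal_bracket_left[OF I] A imat_unit_gl_cf)
  ultimately have "imat_unit i t \<in> I" using lie_ideal_scale_cancel[OF I] pq by metis
  then show ?thesis using that t by blast
qed

definition row_matrix :: "nat \<Rightarrow> (nat \<Rightarrow> 'k) \<Rightarrow> 'k::field imat" where
  "row_matrix i b = (\<lambda>r j. if r = i then b j else 0)"

lemma row_matrix_gl_cf: "row_matrix i b \<in> gl_cf"
  by (auto simp: gl_cf_def row_matrix_def)

text \<open>
  The product \<open>E_it\<close> times the matrix with row \<open>b\<close> in position \<open>t\<close> moves \<open>b\<close> to row \<open>i\<close>; the product in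
  the other order is \<open>b i\<close> times \<open>E_tt\<close>.
\<close>

lemma lie_ideal_row_matrix:
  assumes I: "lie_ideal I" and t: "t \<noteq> i" "imat_unit i t \<in> I" and b: "b i = 0"
  shows "row_matrix i b \<in> I"
proof -
  have "row_matrix i b = lie_bracket (imat_unit i t) (row_matrix t b)"
    using t b by (auto simp: fun_eq_iff lie_bracket_apply imat_mult_unit unit_mult_imat)
      (auto simp: row_matrix_def)
  then show ?thesis using lie_ideal_bracket_right[OF I t(2) row_matrix_gl_cf] by metis
qed

lemma sum_imat_apply: "(\<Sum>s\<in>S. f s) i j = (\<Sum>s\<in>S. f s i j :: 'k::field)"
  by (induction S rule: infinite_finite_induct) auto

text \<open>
  A matrix with finitely many nonzero rows is a finite sum of matrices concentrated in one row with
  \<open>0\<close> on the diagonal, and of a diagonal matrix.  If the trace is \<open>0\<close>, the diagonal matrix is a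
  combination of the differences \<open>E_ii - E_00 = [E_i0, E_0i]\<close>.
\<close>

lemma sl_fr_subset_lie_ideal:
  fixes A :: "'k::field imat"
  assumes I: "lie_ideal I" and A: "A \<in> I" and nonscalar: "A \<notin> d_sc"
  shows "sl_fr \<subseteq> I"
proof -
  \<comment> \<open>For diagonal \<open>A\<close>, the bracket with \<open>E_0i\<close> turns two unequal diagonal entries into an
    off-diagonal one.\<close>
  have "\<exists>D p q. D \<in> I \<and> p \<noteq> q \<and> D p q \<noteq> 0"
  proof (cases "\<exists>p q. p \<noteq> q \<and> A p q \<noteq> 0")
    case False
    have "\<exists>i. A i i \<noteq> A 0 0"
    proof (rule ccontr)
      assume "\<not> ?thesis"
      then have "A = imat_scale (A 0 0) imat_id"
        using False by (auto simp: fun_eq_iff imat_scale_apply imat_id_def)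
      then show False using nonscalar by (auto simp: d_sc_def)
    qed
    then obtain i where i: "A i i \<noteq> A 0 0" by blast
    have "lie_bracket (imat_unit 0 i) A 0 i \<noteq> 0"
      using i by (simp add: lie_bracket_apply imat_mult_unit unit_mult_imat)
    moreover have "lie_bracket (imat_unit 0 i) A \<in> I"
      by (intro lie_ideal_bracket_left[OF I] A imat_unit_gl_cf)
    moreover have "0 \<noteq> i" using i by metis
    ultimately show ?thesis by blast
  qed (use A in blast)
  then obtain D p q where D: "D \<in> I" "p \<noteq> q" "D p q \<noteq> 0" by blast
  have row: "row_matrix i b \<in> I" if "b i = 0" for i b
    using lie_ideal_unit_if_offdiagonal[OF I D, of i] lie_ideal_row_matrix[OF I] that by metis
  have unit: "imat_unit i j \<in> I" if "i \<noteq> j" for i j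
  proof -
    have "imat_unit i j = row_matrix i (\<lambda>k. if k = j then 1 else (0::'k))"
      by (auto simp: fun_eq_iff row_matrix_def imat_unit_def)
    then show ?thesis using row[of "\<lambda>k. if k = j then 1 else 0" i] that by simp
  qed
  have diag: "imat_unit i i - imat_unit 0 0 \<in> I" for i
  proof (cases "i = 0")
    case True
    then show ?thesis using imat.subspace_0[OF lie_ideal_subspace[OF I]] by simp
  next
    case False
    have "imat_unit i i - imat_unit 0 0 = lie_bracket (imat_unit i 0) (imat_unit 0 i :: 'k imat)"
      by (auto simp: fun_eq_iff lie_bracket_apply imat_mult_unit) (auto simp: imat_unit_def)
    then show ?thesis
      using lie_ideal_bracket_right[OF I unit[OF False] imat_unit_gl_cf] by metis
  qed
  show ?thesis
  proof
    fix B :: "'k imat" assume "B \<in> sl_fr"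
    then obtain F where F: "finite F" "\<And>i j. i \<notin> F \<Longrightarrow> B i j = 0"
      using gl_fr_rows unfolding sl_fr_def by blast
    have tr: "(\<Sum>i\<in>F. B i i) = 0"
      using \<open>B \<in> sl_fr\<close> imat_trace_eq_sum[OF F(1), of B] F(2) by (simp add: sl_fr_def)
    define C where "C i = row_matrix i ((B i)(i := 0)) + imat_scale (B i i) (imat_unit i i - imat_unit 0 0)" for i
    have "C i \<in> I" for i unfolding C_def
      by (intro imat.subspace_add imat.subspace_scale lie_ideal_subspace[OF I] row diag) simp
    then have "(\<Sum>i\<in>F. C i) \<in> I" by (rule imat.subspace_sum[OF lie_ideal_subspace[OF I]])
    moreover have "(\<Sum>i\<in>F. C i) = B"
    proof (intro ext)
      fix r j
      have "C i r j = (if r = i then B r j else 0) - B i i * imat_unit 0 0 r j" for i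
        by (auto simp: C_def row_matrix_def imat_scale_apply imat_unit_def algebra_simps)
      then have "(\<Sum>i\<in>F. C i) r j = (\<Sum>i\<in>F. if r = i then B r j else 0) - (\<Sum>i\<in>F. B i i) * imat_unit 0 0 r j"
        by (simp add: sum_imat_apply sum_subtractf sum_distrib_right)
      then show "(\<Sum>i\<in>F. C i) r j = B r j" using F tr by (simp add: sum.delta)
    qed
    ultimately show "B \<in> I" by simp
  qed
qed

section \<open>The classification\<close>

text \<open>
  All diagonal entries of \<open>E + k E_00\<close> except possibly the first are \<open>1\<close>, so a nonzero
  multiple of this matrix has infinitely many nonzero rows.
\<close>

lemma J_line_inter_gl_fr: "J_line k \<inter> gl_fr = {0 :: 'k::field imat}"
proof -
  have "m = 0" if fr: "imat_scale m (imat_id + imat_scale k (imat_unit 0 0)) \<in> gl_fr" for m :: 'k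
  proof -
    obtain F where F: "finite F" "\<And>i j. i \<notin> F \<Longrightarrow>
        imat_scale m (imat_id + imat_scale k (imat_unit 0 0)) i j = 0"
      by (rule gl_fr_rows[OF fr]) blast
    obtain i where "i \<notin> insert 0 F"
      using ex_new_if_finite[OF infinite_UNIV_nat finite.insertI[OF F(1)]] by blast
    then show ?thesis using F(2)[of i i]
      by (simp add: imat_scale_apply imat_id_def imat_unit_def)
  qed
  then show ?thesis
    by (auto simp: J_line_def imat.subspace_0[OF subspace_gl_fr] intro: exI[of _ 0])
qed

lemma lie_ideal_J_ideal: "lie_ideal (J_ideal k)"
proof (rule lie_ideal_between)
  have sub: "imat.subspace (d_sc + gl_fr)" 
    by (intro subspace_set_plus subspace_gl_fr) (simp add: d_sc_eq_span)
  have incl: "d_sc \<subseteq> d_sc + gl_fr" "gl_fr \<subseteq> d_sc + gl_fr"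
    by (rule subset_set_plus; simp add: subspace_gl_fr d_sc_eq_span)+
  have "imat_id \<in> d_sc + gl_fr" using incl(1) by (auto simp: d_sc_eq_span imat.span_base)
  moreover have "imat_scale k (imat_unit 0 0) \<in> d_sc + gl_fr"
    using imat.subspace_scale[OF sub subsetD[OF incl(2) unit_gl_fr]] .
  ultimately have "imat_id + imat_scale k (imat_unit 0 0) \<in> d_sc + gl_fr"
    by (rule imat.subspace_add[OF sub])
  then have "J_line k \<subseteq> d_sc + gl_fr"
    unfolding J_line_eq_span by (intro imat.span_minimal sub) simp
  then show "J_ideal k \<subseteq> d_sc + gl_fr"
    unfolding J_ideal_def using incl(2) by (intro set_plus_subset_subspace[OF sub]) (auto simp: sl_fr_def)
  have J: "imat.subspace (J_line k)" by (simp add: J_line_eq_span)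
  show "imat.subspace (J_ideal k)"
    unfolding J_ideal_def by (rule subspace_set_plus[OF J subspace_sl_fr])
  show "sl_fr \<subseteq> J_ideal k"
    unfolding J_ideal_def by (rule subset_set_plus(2)[OF J subspace_sl_fr])
qed

text \<open>
  For \<open>sl_fr \<subseteq> I \<subseteq> d_sc + gl_fr\<close>, two questions separate the subspaces of the plane spanned by \<open>E\<close> and
  \<open>E_00\<close>: is \<open>E_00\<close> in \<open>I\<close>, and does \<open>I\<close> have an element with nonzero \<open>E\<close>-component, that is, an
  element outside \<open>gl_fr\<close>?  If only the second answer is yes, such an element can be scaled to
  \<open>E + k E_00\<close> modulo \<open>sl_fr\<close>, and \<open>k\<close> is unique because two values would put \<open>E_00\<close> into \<open>I\<close>.
\<close>

lemma lie_ideal_cases: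
  fixes I :: "'k::field imat set"
  assumes I: "lie_ideal I"
  shows "I \<in> {{0}, d_sc, sl_fr, gl_fr, d_sc + gl_fr, gl_cf} \<union> range J_ideal"
proof -
  note S = lie_ideal_subspace[OF I]
  let ?e = "imat_unit 0 0 :: 'k imat"
  show ?thesis
  proof (cases "I \<subseteq> d_sc")
    case True
    show ?thesis
    proof (cases "I = {0}")
      case False
      then obtain A where A: "A \<in> I" "A \<noteq> 0" using imat.subspace_0[OF S] by blast
      then obtain c where c: "A = imat_scale c imat_id" using True by (auto simp: d_sc_def)
      then have "imat_id \<in> I" using A lie_ideal_scale_cancel[OF I, of c] by (cases "c = 0") auto
      then have "d_sc \<subseteq> I" by (simp add: d_sc_eq_span imat.span_minimal S)
      then show ?thesis using True by blast
    qed simp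
  next
    case False
    then have sl: "sl_fr \<subseteq> I" using sl_fr_subset_lie_ideal[OF I] by blast
    show ?thesis
    proof (cases "I \<subseteq> d_sc + gl_fr")
      case False
      then show ?thesis using lie_ideal_eq_gl_cf[OF I] by blast
    next
      case upper: True
      have split: "\<exists>a b s. A = imat_scale a imat_id + imat_scale b ?e + s \<and> s \<in> sl_fr"
        if "A \<in> I" for A
      proof -
        obtain a B where "A = imat_scale a imat_id + B" "B \<in> gl_fr"
          using \<open>A \<in> I\<close> upper by (auto simp: set_plus_def d_sc_def)
        then show ?thesis using gl_fr_minus_trace_in_sl_fr[of B]
          by (intro exI[of _ a] exI[of _ "imat_trace B"] exI[of _ "B - imat_scale (imat_trace B) ?e"]) simp
      qed
      have e: "b = 0 \<or> ?e \<in> I" if "imat_scale b ?e + s \<in> I" "s \<in> sl_fr" for b s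
      proof -
        have "imat_scale b ?e \<in> I"
          using imat.subspace_diff[OF S that(1), of s] that(2) sl by auto
        then show ?thesis using lie_ideal_scale_cancel[OF I] by blast
      qed
      have gl: "gl_fr \<subseteq> I" if "?e \<in> I"
      proof
        fix B :: "'k imat" assume "B \<in> gl_fr"
        then have "B - imat_scale (imat_trace B) ?e \<in> I" using gl_fr_minus_trace_in_sl_fr sl by blast
        from imat.subspace_add[OF S this imat.subspace_scale[OF S that, of "imat_trace B"]]
        show "B \<in> I" by simp
      qed
      have sl_gl: "s \<in> gl_fr" if "s \<in> sl_fr" for s using that by (simp add: sl_fr_def)
      show ?thesis
      proof (cases "I \<subseteq> gl_fr")
        case True
        show ?thesis
        proof (cases "?e \<in> I")
          case True
          then show ?thesis using gl \<open>I \<subseteq> gl_fr\<close> by blast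
        next
          case False
          have "I \<subseteq> sl_fr"
          proof
            fix A assume A: "A \<in> I"
            then obtain B where B: "A = imat_scale (imat_trace A) ?e + B" "B \<in> sl_fr"
              using gl_fr_minus_trace_in_sl_fr[of A] \<open>I \<subseteq> gl_fr\<close>
              by (metis diff_add_cancel add.commute subsetD)
            then have "imat_trace A = 0" using e[of "imat_trace A" B] A False by auto
            then show "A \<in> sl_fr" using A \<open>I \<subseteq> gl_fr\<close> by (auto simp: sl_fr_def)
          qed
          then show ?thesis using sl by blast
        qed
      next
        case False
        then obtain A where A: "A \<in> I" "A \<notin> gl_fr" by blast
        then obtain a b s where abs: "A = imat_scale a imat_id + imat_scale b ?e + s" "s \<in> sl_fr"
          using split by blast
        have "a \<noteq> 0"
        proof
          assume "a = 0"
          then have "A = imat_scale b ?e + s" by (simp add: abs)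
          then show False
            using A(2) imat.subspace_add[OF subspace_gl_fr
                imat.subspace_scale[OF subspace_gl_fr unit_gl_fr] sl_gl[OF abs(2)]] by metis
        qed
        define k where "k = b / a"
        have "imat_scale a (imat_id + imat_scale k ?e) = A - s"
          using \<open>a \<noteq> 0\<close> abs by (simp add: imat.scale_right_distrib k_def)
        then have gen: "imat_id + imat_scale k ?e \<in> I"
          using lie_ideal_scale_cancel[OF I _ \<open>a \<noteq> 0\<close>] imat.subspace_diff[OF S A(1)] abs(2) sl by auto
        show ?thesis
        proof (cases "?e \<in> I")
          case True
          have "imat_id \<in> I"
            using imat.subspace_diff[OF S gen imat.subspace_scale[OF S True, of k]] by simp
          then have "d_sc \<subseteq> I" by (simp add: d_sc_eq_span imat.span_minimal S)
          then have "d_sc + gl_fr \<subseteq> I" using gl[OF True] by (rule set_plus_subset_subspace[OF S])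
          then show ?thesis using upper by blast
        next
          case False
          have "J_ideal k \<subseteq> I"
            unfolding J_ideal_def J_line_eq_span using gen sl
            by (intro set_plus_subset_subspace[OF S] imat.span_minimal S) auto
          moreover have "I \<subseteq> J_ideal k"
          proof
            fix B assume B: "B \<in> I"
            then obtain c d u where u: "B = imat_scale c imat_id + imat_scale d ?e + u" "u \<in> sl_fr"
              using split by blast
            have "B = imat_scale c (imat_id + imat_scale k ?e) + (imat_scale (d - c * k) ?e + u)"
              by (simp add: u imat.scale_right_distrib imat.scale_left_diff_distrib)
            moreover from this have "imat_scale (d - c * k) ?e + u \<in> I"
              using imat.subspace_diff[OF S B imat.subspace_scale[OF S gen, of c]] by simp
            then have "d - c * k = 0" using e[OF _ u(2)] False by blast
            ultimately have "B = imat_scale c (imat_id + imat_scale k ?e) + u" by simp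
            then show "B \<in> J_ideal k" unfolding J_ideal_def J_line_def using u(2)
              by (blast intro: set_plus_intro)
          qed
          ultimately show ?thesis by blast
        qed
      qed
    qed
  qed
qed

theorem theorem1p1:
  shows "{I :: 'k::field imat set. lie_ideal I} =
           {{0}, d_sc, sl_fr, gl_fr, d_sc + sl_fr, d_sc + gl_fr, gl_cf} \<union> {J_ideal k |k. k \<noteq> 0}
         \<and> (d_sc :: 'k imat set) \<inter> sl_fr = {0}
         \<and> (d_sc :: 'k imat set) \<inter> gl_fr = {0}
         \<and> (\<forall>k :: 'k. J_line k \<inter> sl_fr = {0})"
proof (intro conjI allI)
  have J0: "d_sc + sl_fr = (J_ideal 0 :: 'k imat set)" by (simp add: J_ideal_def J_line_0)
  have 0: "lie_ideal {0 :: 'k imat}"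
  proof -
    have "{0 :: 'k imat} \<subseteq> d_sc" by (simp add: d_sc_eq_span imat.span_zero)
    then show ?thesis using lie_bracket_scalar d_sc_gl_cf imat.subspace_single_0
      by (auto simp: lie_ideal_def)
  qed
  have sub: "imat.subspace (d_sc :: 'k imat set)" by (simp add: d_sc_eq_span)
  have d: "lie_ideal (d_sc :: 'k imat set)"
    using imat.subspace_0[OF sub]
    by (auto simp: lie_ideal_def sub lie_bracket_scalar subsetD[OF d_sc_gl_cf])
  have fr: "gl_fr \<subseteq> d_sc + (gl_fr :: 'k imat set)"
    by (rule subset_set_plus(2)[OF sub subspace_gl_fr])
  have sf: "sl_fr \<subseteq> (gl_fr :: 'k imat set)" by (auto simp: sl_fr_def)
  have "lie_ideal (sl_fr :: 'k imat set)" "lie_ideal (gl_fr :: 'k imat set)"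
    "lie_ideal (d_sc + gl_fr :: 'k imat set)"
    using fr sf sub by (intro lie_ideal_between subspace_sl_fr subspace_gl_fr subspace_set_plus; blast)+
  moreover have "lie_ideal (gl_cf :: 'k imat set)"
    by (auto simp: lie_ideal_def subspace_gl_cf lie_bracket_gl_cf)
  ultimately have ideals: "lie_ideal I" 
    if "I \<in> {{0}, d_sc, sl_fr, gl_fr, d_sc + sl_fr, d_sc + gl_fr, gl_cf} \<union> {J_ideal k |k. k \<noteq> 0}"
    for I :: "'k imat set"
    using that 0 d lie_ideal_J_ideal unfolding J0 by blast
  show "{I :: 'k::field imat set. lie_ideal I} =
      {{0}, d_sc, sl_fr, gl_fr, d_sc + sl_fr, d_sc + gl_fr, gl_cf} \<union> {J_ideal k |k. k \<noteq> 0}"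
    (is "_ = ?R")
  proof (rule set_eqI)
    fix I :: "'k imat set"
    have "I \<in> ?R" if "lie_ideal I"
      using lie_ideal_cases[OF that] unfolding J0 by blast
    then show "I \<in> {I. lie_ideal I} \<longleftrightarrow> I \<in> ?R" using ideals by blast
  qed
  have "(0 :: 'k imat) \<in> sl_fr" using imat.subspace_0[OF subspace_sl_fr] .
  then show J: "J_line k \<inter> sl_fr = {0 :: 'k imat}" for k
    using J_line_inter_gl_fr[of k] sf by blast
  show "(d_sc :: 'k imat set) \<inter> sl_fr = {0}" using J[of 0] by (simp add: J_line_0)
  show "(d_sc :: 'k imat set) \<inter> gl_fr = {0}" using J_line_inter_gl_fr[of 0] by (simp add: J_line_0)
qed

end
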